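(* Let $S$ be a set, let $c:2^S\to 2^S$ be complementation $c(A)=S\setminus A$, and let $p,q:2^S\to 2^S$ be closure operators on $S$ that commute, i.e. $pq=qp$. Then for all integers $n\ge 1$ and all $a_1,a_2,\ldots,a_{2n}\in\{p,q,pq\}$, we have $$pq\,c\,a_1\,c\,a_2\,c\cdots a_{2n}\,c\,pq \;=\; pq\,c\,pq$$ as maps $2^S\to 2^S$.
   Context: A closure operator on a set $S$ is a map $k:2^S\to 2^S$ such that for all $A,B\subseteq S$: (1) $A\subseteq k(A)$; (2) $A\subseteq B$ implies $k(A)\subseteq k(B)$; (3) $k(k(A))=k(A)$. Concatenation of operators denotes composition, with the rightmost operator applied first, e.g. $pcq(A)=p(c(q(A)))$. In the left-hand word the operators $a_1,\ldots,a_{2n}$ appear in order, with one $c$ before $a_1$, one $c$ between consecutive $a_i$, and one $c$ after $a_{2n}$ (so $2n+1$ occurrences of $c$ in total). Equality of operators means that they agree on all subsets of $S$. *)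

theory Defs
  imports Main "HOL-Library.FuncSet"
begin

text \<open>
  An operator on \<open>S\<close>, that is, a map \<open>2\<^sup>S \<rightarrow> 2\<^sup>S\<close>, is represented by a function on all sets of the
  element type which maps \<open>Pow S\<close> to itself; its values outside \<open>Pow S\<close> are irrelevant.
\<close>

definition closure_operator_on :: "'a set \<Rightarrow> ('a set \<Rightarrow> 'a set) \<Rightarrow> bool" where
  "closure_operator_on S k \<longleftrightarrow>
     k \<in> Pow S \<rightarrow> Pow S \<and>
     (\<forall>A. A \<subseteq> S \<longrightarrow> A \<subseteq> k A) \<and>
     (\<forall>A B. A \<subseteq> B \<and> B \<subseteq> S \<longrightarrow> k A \<subseteq> k B) \<and>
     (\<forall>A. A \<subseteq> S \<longrightarrow> k (k A) = k A)"

definition complement_on :: "'a set \<Rightarrow> 'a set \<Rightarrow> 'a set" where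
  "complement_on S A = S - A"

definition eq_on_subsets :: "'a set \<Rightarrow> ('a set \<Rightarrow> 'a set) \<Rightarrow> ('a set \<Rightarrow> 'a set) \<Rightarrow> bool" where
  "eq_on_subsets S f g \<longleftrightarrow> (\<forall>A. A \<subseteq> S \<longrightarrow> f A = g A)"

text \<open>\<open>complement_word S [a\<^sub>1, \<dots>, a\<^sub>m]\<close> is the composite \<open>c a\<^sub>1 c a\<^sub>2 c \<dots> c a\<^sub>m c\<close>, with \<open>m + 1\<close>
  occurrences of the complementation \<open>c\<close>.\<close>

fun complement_word :: "'a set \<Rightarrow> ('a set \<Rightarrow> 'a set) list \<Rightarrow> 'a set \<Rightarrow> 'a set" where
  "complement_word S [] = complement_on S"
| "complement_word S (a # as) = complement_on S \<circ> a \<circ> complement_word S as"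

end

(*
  Put k = pq and B = c k A, so that c B is closed under k and hence under p and q.
  Each pair c a c b sends every set W with B <= W <= k B to another such set, because
  b W lies between B and k B and c a c is an interior operator fixing B.
  Hence the inner word lies between B and k B, and applying k gives k B.
*)

theory Submission
  imports Defs
begin

lemma closure_operator_onD:
  assumes "closure_operator_on S k"
  shows closure_operator_on_closed: "A \<subseteq> S \<Longrightarrow> k A \<subseteq> S"
    and closure_operator_on_extensive: "A \<subseteq> S \<Longrightarrow> A \<subseteq> k A"
    and closure_operator_on_mono: "A \<subseteq> B \<Longrightarrow> B \<subseteq> S \<Longrightarrow> k A \<subseteq> k B"
    and closure_operator_on_idem: "A \<subseteq> S \<Longrightarrow> k (k A) = k A"
  using assms unfolding closure_operator_on_def Pi_iff Pow_iff by simp_all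

text \<open>Commutation gives idempotence, since \<open>p q p q\<close> rearranges to
  \<open>p p q q\<close>; the other closure axioms pass through the composition one factor at a
  time.\<close>

lemma closure_operator_on_comp:
  assumes p: "closure_operator_on S p" and q: "closure_operator_on S q"
    and comm: "eq_on_subsets S (p \<circ> q) (q \<circ> p)"
  shows "closure_operator_on S (p \<circ> q)"
proof -
  note P = closure_operator_onD[OF p] and Q = closure_operator_onD[OF q]
  have idem: "p (q (p (q A))) = p (q A)" if A: "A \<subseteq> S" for A
  proof -
    have "q (p (q A)) = p (q (q A))"
      using comm Q(1)[OF A] unfolding eq_on_subsets_def by simp
    then show ?thesis using Q(4)[OF A] P(4)[OF Q(1)[OF A]] by simp
  qed
  have ext: "A \<subseteq> p (q A)" if A: "A \<subseteq> S" for A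
    using Q(2)[OF A] P(2)[OF Q(1)[OF A]] by (rule subset_trans)
  have mono: "p (q A) \<subseteq> p (q B)" if "A \<subseteq> B" "B \<subseteq> S" for A B
    using P(3)[OF Q(3)[OF that] Q(1)[OF that(2)]] .
  have closed: "p (q A) \<subseteq> S" if "A \<subseteq> S" for A
    using P(1)[OF Q(1)[OF that]] .
  show ?thesis
    unfolding closure_operator_on_def Pi_iff Pow_iff comp_apply
    by (simp add: idem ext mono closed)
qed

text \<open>The operator \<open>k\<close> stays abstract, tied to the letters by
  \<open>absorb\<close>: each letter fixes every set closed under \<open>k\<close>. In a pair
  \<open>a\<close>, \<open>b\<close> this is used for \<open>b\<close> at \<open>S - k A\<close> to
  keep the upper bound, and for \<open>a\<close> at \<open>A\<close> to keep the lower one.\<close>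

lemma complement_word_bounds:
  assumes k: "closure_operator_on S k"
    and closure: "\<And>a. a \<in> set as \<Longrightarrow> closure_operator_on S a"
    and absorb: "\<And>a A. a \<in> set as \<Longrightarrow> A \<subseteq> S \<Longrightarrow> a (k A) = k A"
    and len: "even (length as)"
    and A: "A \<subseteq> S"
  shows "S - k A \<subseteq> complement_word S as (k A) \<and>
    complement_word S as (k A) \<subseteq> k (S - k A)"
  using closure absorb len
\<comment> \<open>Letters are removed in pairs, because \<open>c a\<close> reverses inclusions
  between subsets of \<open>S\<close> while \<open>c a c b\<close> preserves them. The one-letter
  case contradicts \<open>len\<close>.\<close>
proof (induction as rule: induct_list012)
  case 1
  show ?case
    using closure_operator_on_extensive[OF k, of "S - k A"] by (auto simp: complement_on_def)
next
  case (2 a)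
  then show ?case by simp
next
  case (3 a b as)
  define B where "B = S - k A"
  define W where "W = complement_word S as (k A)"
  have W: "B \<subseteq> W" "W \<subseteq> k B"
    using "3.IH"(1) "3.prems" unfolding W_def B_def by simp_all
  have B: "B \<subseteq> S" by (auto simp: B_def)
  have kB: "k B \<subseteq> S" and kA: "k A \<subseteq> S"
    using closure_operator_on_closed[OF k] A B by auto
  have a: "closure_operator_on S a" and b: "closure_operator_on S b"
    using "3.prems"(1) by auto
  have WS: "W \<subseteq> S" using W kB by blast
  have bW: "B \<subseteq> b W"
    using closure_operator_on_extensive[OF b WS] W by blast
  have "b W \<subseteq> b (k B)"
    using closure_operator_on_mono[OF b W(2) kB] .
  then have bW': "b W \<subseteq> k B" using "3.prems"(2)[of b B] B by simp
  \<comment> \<open>Complementing turns the lower bound on \<open>b W\<close> into an upper bound by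
    \<open>k A\<close>, a set that \<open>a\<close> fixes; so applying \<open>a\<close> does not
    lead outside \<open>k A\<close>.\<close>
  have "S - b W \<subseteq> k A" using bW by (auto simp: B_def)
  then have "a (S - b W) \<subseteq> a (k A)" by (rule closure_operator_on_mono[OF a _ kA])
  also have "a (k A) = k A" using "3.prems"(2)[of a A] A by simp
  finally have "a (S - b W) \<subseteq> k A" .
  then have "B \<subseteq> S - a (S - b W)" by (auto simp: B_def)
  \<comment> \<open>Since \<open>a\<close> enlarges \<open>S - b W\<close>, complementing again
    gives a subset of \<open>b W\<close>, which already lies in \<open>k B\<close>.\<close>
  moreover have "S - a (S - b W) \<subseteq> k B"
    using closure_operator_on_extensive[OF a, of "S - b W"] bW' by blast
  ultimately show ?case
    by (simp add: complement_on_def W_def B_def)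
qed

theorem theorem4:
  fixes S :: "'a set" and p q :: "'a set \<Rightarrow> 'a set"
    and n :: nat and as :: "('a set \<Rightarrow> 'a set) list"
  assumes "closure_operator_on S p"
    and "closure_operator_on S q"
    and "eq_on_subsets S (p \<circ> q) (q \<circ> p)"
    and "n \<ge> 1"
    and "length as = 2 * n"
    and "set as \<subseteq> {p, q, p \<circ> q}"
  shows "eq_on_subsets S
           ((p \<circ> q) \<circ> complement_word S as \<circ> (p \<circ> q))
           ((p \<circ> q) \<circ> complement_on S \<circ> (p \<circ> q))"
proof -
  define k where "k = p \<circ> q"
  have k: "closure_operator_on S k"
    unfolding k_def using closure_operator_on_comp assms(1-3) .
  note P = closure_operator_onD[OF assms(1)] and Q = closure_operator_onD[OF assms(2)]
    and K = closure_operator_onD[OF k]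
  have pk: "p (k A) = k A" if "A \<subseteq> S" for A
    using P(4)[OF Q(1)[OF that]] by (simp add: k_def)
  \<comment> \<open>Unlike \<open>p\<close>, the outer factor of \<open>k\<close>, the operator
    \<open>q\<close> must first be moved past \<open>p\<close> by commutation before its idempotence
    applies.\<close>
  have qk: "q (k A) = k A" if "A \<subseteq> S" for A
  proof -
    have "q (p (q A)) = p (q (q A))"
      using assms(3) Q(1)[OF that] unfolding eq_on_subsets_def by simp
    then show ?thesis using Q(4)[OF that] by (simp add: k_def)
  qed
  have as: "set as \<subseteq> {p, q, k}" using assms(6) by (simp add: k_def)
  have "k (complement_word S as (k A)) = k (S - k A)" if A: "A \<subseteq> S" for A
  proof -
    define W where "W = complement_word S as (k A)"
    have closure: "closure_operator_on S a" if "a \<in> set as" for a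
      using that as assms(1,2) k by auto
    have absorb: "a (k C) = k C" if "a \<in> set as" "C \<subseteq> S" for a C
      using that as pk qk K(4) by auto
    have "even (length as)" using assms(5) by simp
    then have "S - k A \<subseteq> W \<and> W \<subseteq> k (S - k A)"
      unfolding W_def using complement_word_bounds[OF k] closure absorb A by simp
    then have W: "S - k A \<subseteq> W" "W \<subseteq> k (S - k A)" by simp_all
    have kB: "k (S - k A) \<subseteq> S" using K(1) by simp
    \<comment> \<open>The bounds on \<open>W\<close> differ only by an application of
      \<open>k\<close>, so idempotence makes them coincide after applying \<open>k\<close>.\<close>
    have "k W \<subseteq> k (S - k A)" using K(3)[OF W(2) kB] K(4) by simp
    moreover have "k (S - k A) \<subseteq> k W" using K(3)[OF W(1)] W(2) kB by simp
    ultimately show ?thesis by (simp add: W_def)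
  qed
  then show ?thesis
    unfolding eq_on_subsets_def k_def[symmetric] by (simp add: complement_on_def)
qed

end
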